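(* Let $n\ge 1$ be an integer and let $\mathcal{T}: L^1(\mathbb{Z}/n\mathbb{Z})\to L^1(\mathbb{Z}/n\mathbb{Z})$ be a continuous linear operator such that there exist two maps $\varphi,\psi:\mathbb{Z}/n\mathbb{Z}\to\mathbb{C}$ for which, for every integer $k$, $$\mathcal{T}\tau_k=M_k^{(\varphi)}\mathcal{T}\quad\text{and}\quad \mathcal{T}M_k^{(\psi)}=\tau_k\mathcal{T}.$$ Then there exist $k_0,m_0,m_1\in\mathbb{Z}/n\mathbb{Z}$ and $c\in\mathbb{C}$ such that, for all $j\in\mathbb{Z}/n\mathbb{Z}$, $$\varphi(j)=\frac{2i\pi}{n}(k_0j+m_0)\quad\text{and}\quad \psi(j)=\frac{2i\pi}{n}(-k_0j+m_1)\qquad\text{modulo } 2i\pi\mathbb{Z},$$ and, for all $a\in L^1(\mathbb{Z}/n\mathbb{Z})$ and $\ell\in\mathbb{Z}/n\mathbb{Z}$, $$\mathcal{T}(a)(\ell)=c\,e^{2i\pi\ell m_1/n}\,\hat a(k_0\ell+m_0).$$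
   Context: $L^1(\mathbb{Z}/n\mathbb{Z})$ is the space of all functions $\mathbb{Z}/n\mathbb{Z}\to\mathbb{C}$. For an integer $k$ and a map $\varphi:\mathbb{Z}/n\mathbb{Z}\to\mathbb{C}$, the linear operators $\tau_k$ and $M_k^{(\varphi)}$ on $L^1(\mathbb{Z}/n\mathbb{Z})$ are defined by $\tau_ka(j)=a(j+k)$ (with $j+k$ taken modulo $n$) and $M_k^{(\varphi)}a(j)=e^{k\varphi(j)}a(j)$. The maps $\varphi,\psi$ matter only modulo $2i\pi\mathbb{Z}$, i.e. they are regarded as maps into $\mathbb{C}/2i\pi\mathbb{Z}$. The Fourier transform is $\hat a(\ell)=\sum_{j\in\mathbb{Z}/n\mathbb{Z}}a(j)e^{-2i\pi j\ell/n}$.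
   Formalization: The operator T is additionally assumed to be nonzero; for T = 0 both relations hold for arbitrary φ and ψ (e.g. n = 1, φ = ψ = 1/3), so the claimed form of φ and ψ fails. *)

theory Defs
  imports
    "HOL-Analysis.Analysis"
    "HOL-Library.Function_Algebras"
    "Berlekamp_Zassenhaus.Finite_Field"
begin

text \<open>
  The ring of integers modulo \<open>n\<close> is the type \<open>'n mod_ring\<close> with \<open>n = CARD('n)\<close>, where
  \<open>'n\<close> is an arbitrary finite type. Types are nonempty, so this covers exactly the integers
  \<open>n \<ge> 1\<close>, including \<open>n = 1\<close>. The map \<open>of_int_mod_ring\<close> is reduction modulo \<open>n\<close> and
  \<open>to_int_mod_ring\<close> is the representative in \<open>{0..<n}\<close>.
\<close>

type_synonym 'n L1 = "'n mod_ring \<Rightarrow> complex"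

definition L1_norm :: "'n::finite L1 \<Rightarrow> real" where
  "L1_norm a = (\<Sum>j\<in>UNIV. norm (a j))"

definition L1_topology :: "'n::finite L1 topology" where
  "L1_topology = Metric_space.mtopology UNIV (\<lambda>a b. L1_norm (a - b))"

definition L1_scale :: "complex \<Rightarrow> 'n::finite L1 \<Rightarrow> 'n L1" where
  "L1_scale c a = (\<lambda>j. c * a j)"

definition translation :: "int \<Rightarrow> 'n::finite L1 \<Rightarrow> 'n L1" where
  "translation k a = (\<lambda>j. a (j + of_int_mod_ring k))"

definition modulation :: "('n::finite mod_ring \<Rightarrow> complex) \<Rightarrow> int \<Rightarrow> 'n L1 \<Rightarrow> 'n L1" where
  "modulation \<phi> k a = (\<lambda>j. exp (of_int k * \<phi> j) * a j)"

definition fourier :: "'n::finite L1 \<Rightarrow> 'n L1" where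
  "fourier a l =
     (\<Sum>j\<in>UNIV. a j * exp (- (2 * \<i> * of_real pi * of_int (to_int_mod_ring j)
                              * of_int (to_int_mod_ring l) / of_nat CARD('n))))"

definition cong_2pi_i :: "complex \<Rightarrow> complex \<Rightarrow> bool" where
  "cong_2pi_i z w \<longleftrightarrow> (\<exists>q::int. z - w = of_int q * (2 * \<i> * of_real pi))"

text \<open>
  \<open>Metric_space.mtopology\<close> and \<open>Vector_Spaces.linear\<close> have their usual meaning only for a metric
  and for vector spaces, respectively; the next two lemmas establish this.
\<close>

lemma Metric_space_L1: "Metric_space UNIV (\<lambda>a b :: 'n::finite L1. L1_norm (a - b))"
proof
  fix a b c :: "'n L1"
  show "0 \<le> L1_norm (a - b)"
    by (simp add: L1_norm_def sum_nonneg)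
  show "L1_norm (a - b) = L1_norm (b - a)"
    by (simp add: L1_norm_def norm_minus_commute)
  show "L1_norm (a - b) = 0 \<longleftrightarrow> a = b"
    by (simp add: L1_norm_def sum_nonneg_eq_0_iff fun_eq_iff)
  have "L1_norm (a - c) \<le> (\<Sum>j\<in>UNIV. norm (a j - b j) + norm (b j - c j))"
    unfolding L1_norm_def
    by (rule sum_mono) (simp, metis diff_add_cancel add_diff_eq norm_triangle_ineq)
  then show "L1_norm (a - c) \<le> L1_norm (a - b) + L1_norm (b - c)"
    by (simp add: L1_norm_def sum.distrib)
qed

lemma vector_space_L1: "vector_space (L1_scale :: complex \<Rightarrow> 'n::finite L1 \<Rightarrow> 'n L1)"
  by unfold_locales (auto simp: L1_scale_def fun_eq_iff algebra_simps)

end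

theory Submission
  imports Defs
begin

text \<open>
  Let \<open>K l j = T \<delta>\<^sub>j l\<close> be the matrix of \<open>T\<close>, where \<open>\<delta>\<^sub>j\<close> is the point mass at \<open>j\<close>. Point masses
  are permuted by the translations and are eigenvectors of the modulations, so the two
  intertwining relations say that moving one step along a row \<open>l\<close> of \<open>K\<close> multiplies the entry
  by \<open>exp (- \<phi> l)\<close>, and moving one step along a column \<open>j\<close> multiplies it by \<open>exp (\<psi> j)\<close>.

  This has two consequences. First, as \<open>T \<noteq> 0\<close>, some entry of \<open>K\<close> is nonzero, and hence, by
  moving along its row and then along columns, every entry is. Going once around the cycle
  therefore shows that \<open>exp (\<phi> l)\<close> and \<open>exp (\<psi> j)\<close> are \<open>n\<close>-th roots of unity, i.e. values
  \<open>e (p l)\<close> and \<open>e (q j)\<close> of the standard additive character \<open>e\<close> of the ring of integers modulo \<open>n\<close>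
  (lemma \<open>geometric_cyclic\<close>). Second, the entry \<open>K l j\<close> can be reached from \<open>K 0 0\<close> in two
  orders, row first or column first. Since \<open>e\<close> is injective, comparing the two values gives
  \<open>q j * l - p 0 * j = q 0 * l - p l * j\<close>. Putting \<open>j = 1\<close>, respectively
  \<open>l = 1\<close>, shows that \<open>p\<close> and \<open>q\<close> are affine with opposite slopes, \<open>p l = k\<^sub>0 * l + m\<^sub>0\<close> and
  \<open>q j = - k\<^sub>0 * j + m\<^sub>1\<close> (lemma \<open>bigeometric_matrix\<close>). Then
  \<open>K l j = K 0 0 * e (m\<^sub>1 * l) * e (- (k\<^sub>0 * l + m\<^sub>0) * j)\<close>, which is the kernel of the asserted Fourier transform, with \<open>c = K 0 0\<close>.
\<close>

section \<open>The standard additive character\<close>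

definition addchar :: "'n::finite mod_ring \<Rightarrow> complex" where
  "addchar x = exp (2 * \<i> * of_real pi / of_nat CARD('n) * of_int (to_int_mod_ring x))"

lemma addchar_nonzero [simp]: "addchar x \<noteq> 0"
  by (simp add: addchar_def)

lemma cong_2pi_i_iff_exp_eq: "cong_2pi_i z w \<longleftrightarrow> exp z = exp w"
  unfolding cong_2pi_i_def exp_eq by (simp add: algebra_simps)

lemma exp_2pi_i_div_eq_iff:
  assumes "n > 0"
  shows "exp (2 * \<i> * of_real pi / of_nat n * of_int a)
           = exp (2 * \<i> * of_real pi / of_nat n * of_int b)
         \<longleftrightarrow> a mod int n = b mod int n"
proof -
  have "2 * \<i> * of_real pi / of_nat n * of_int a - 2 * \<i> * of_real pi / of_nat n * of_int b
      = of_int q * (2 * \<i> * of_real pi) \<longleftrightarrow> a - b = int n * q" (is "?d = _ \<longleftrightarrow> _") for q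
  proof -
    have "?d = (of_int (a - b) / of_nat n) * (2 * \<i> * of_real pi)"
      by (simp add: diff_divide_distrib algebra_simps)
    moreover have "of_int (a - b) / of_nat n = (of_int q :: complex)
        \<longleftrightarrow> (of_int (a - b) :: complex) = of_int (int n * q)"
      using assms by (simp add: field_simps)
    ultimately show ?thesis
      by (simp only: mult_cancel_right of_int_eq_iff) simp
  qed
  then show ?thesis
    unfolding cong_2pi_i_iff_exp_eq [symmetric] cong_2pi_i_def
    by (simp add: mod_eq_dvd_iff dvd_def)
qed

lemma cong_2pi_i_iff_addchar:
  fixes x :: "'n::finite mod_ring"
  shows "cong_2pi_i z (2 * \<i> * of_real pi / of_nat CARD('n) * of_int (to_int_mod_ring x))
           \<longleftrightarrow> exp z = addchar x"
  by (simp add: cong_2pi_i_iff_exp_eq addchar_def)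

lemma addchar_of_int:
  "addchar (of_int_mod_ring m :: 'n::finite mod_ring)
     = exp (2 * \<i> * of_real pi / of_nat CARD('n) * of_int m)"
proof -
  have "to_int_mod_ring (of_int_mod_ring m :: 'n mod_ring) = m mod int CARD('n)"
    by transfer simp
  then show ?thesis
    by (simp only: addchar_def exp_2pi_i_div_eq_iff [OF zero_less_card_finite] mod_mod_trivial)
qed

lemma add_eq_of_int:
  "x + y = (of_int_mod_ring (to_int_mod_ring x + to_int_mod_ring y) :: 'n::finite mod_ring)"
  by transfer simp

lemma mult_eq_of_int:
  "x * y = (of_int_mod_ring (to_int_mod_ring x * to_int_mod_ring y) :: 'n::finite mod_ring)"
  by transfer simp

lemma of_int_mult_eq_of_int:
  "of_int_mod_ring k * x = (of_int_mod_ring (k * to_int_mod_ring x) :: 'n::finite mod_ring)"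
  by transfer (simp add: mod_simps)

lemma of_int_1_mult: "of_int_mod_ring 1 * x = (x :: 'n::finite mod_ring)"
  by (simp add: of_int_mult_eq_of_int)

lemma addchar_zero [simp]: "addchar 0 = 1"
  by (simp add: addchar_def)

lemma addchar_add: "addchar (x + y) = addchar x * addchar y"
  unfolding add_eq_of_int addchar_of_int by (simp add: addchar_def exp_add distrib_left)

lemma addchar_minus: "addchar (- x) = inverse (addchar x)"
proof -
  have "addchar (- x) * addchar x = 1"
    by (simp flip: addchar_add)
  then show ?thesis
    by (simp add: field_simps)
qed

lemma addchar_diff: "addchar (x - y) = addchar x / addchar y"
  using addchar_add [of x "- y"] by (simp add: addchar_minus divide_inverse)

lemma inj_addchar: "inj (addchar :: 'n::finite mod_ring \<Rightarrow> complex)"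
proof (rule injI)
  fix x y :: "'n mod_ring"
  assume "addchar x = addchar y"
  then have "to_int_mod_ring x mod int CARD('n) = to_int_mod_ring y mod int CARD('n)"
    by (simp only: addchar_def exp_2pi_i_div_eq_iff [OF zero_less_card_finite])
  then show "x = y"
    by transfer simp
qed

lemma exp_of_int_mult_addchar:
  assumes "exp z = addchar p"
  shows "exp (of_int k * z) = addchar (of_int_mod_ring k * p)"
proof -
  have "exp (of_int k * z) = exp z powi k"
    by (simp add: exp_power_int)
  also have "\<dots> = addchar (of_int_mod_ring k * p)"
    unfolding assms of_int_mult_eq_of_int addchar_of_int
    by (simp add: addchar_def exp_power_int mult_ac)
  finally show ?thesis .
qed

lemma root_of_unity_addchar:
  assumes "exp (of_nat CARD('n) * z) = 1"
  shows "\<exists>p :: 'n::finite mod_ring. exp z = addchar p"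
proof -
  have "cong_2pi_i (of_nat CARD('n) * z) 0"
    using assms by (simp add: cong_2pi_i_iff_exp_eq)
  then obtain q :: int where "of_nat CARD('n) * z = of_int q * (2 * \<i> * of_real pi)"
    unfolding cong_2pi_i_def by auto
  then have "z = 2 * \<i> * of_real pi / of_nat CARD('n) * of_int q"
    by (simp add: field_simps)
  then have "exp z = addchar (of_int_mod_ring q :: 'n mod_ring)"
    by (simp add: addchar_of_int)
  then show ?thesis ..
qed

lemma fourier_eq_addchar:
  fixes l :: "'n::finite mod_ring"
  shows "fourier a l = (\<Sum>j\<in>UNIV. a j * addchar (- (l * j)))"
proof -
  have "addchar (- (l * j)) = exp (- (2 * \<i> * of_real pi * of_int (to_int_mod_ring j)
          * of_int (to_int_mod_ring l) / of_nat CARD('n)))" for j :: "'n mod_ring"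
    unfolding addchar_minus mult_eq_of_int addchar_of_int exp_minus [symmetric]
    by (simp add: mult_ac)
  then show ?thesis
    by (simp add: fourier_def)
qed

text \<open>
  A geometric progression on a finite cycle that is not identically zero closes up, which forces
  its ratio to be a root of unity. Both the rows and the columns of the matrix of \<open>T\<close> have this
  form.
\<close>

lemma geometric_cyclic:
  fixes f :: "'n::finite mod_ring \<Rightarrow> complex"
  assumes step: "\<And>k j. f (j + of_int_mod_ring k) = exp (of_int k * z) * f j"
    and nz: "f j\<^sub>0 \<noteq> 0"
  shows "\<exists>p. exp z = addchar p \<and> (\<forall>j. f j = f 0 * addchar (p * j))"
proof -
  have "(of_int_mod_ring (int CARD('n)) :: 'n mod_ring) = 0"
    by transfer simp
  then have "exp (of_nat CARD('n) * z) = 1"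
    using step [of j\<^sub>0 "int CARD('n)"] nz by simp
  then obtain p :: "'n mod_ring" where p: "exp z = addchar p"
    using root_of_unity_addchar by blast
  have "f j = f 0 * addchar (p * j)" for j
    using step [of 0 "to_int_mod_ring j"]
    unfolding exp_of_int_mult_addchar [OF p] by (simp add: mult.commute)
  with p show ?thesis
    by blast
qed

section \<open>The matrix of the operator\<close>

definition point_mass :: "'n::finite mod_ring \<Rightarrow> 'n L1" where
  "point_mass j = (\<lambda>i. of_bool (i = j))"

lemma L1_linear_expansion:
  fixes T :: "'n::finite L1 \<Rightarrow> 'n L1"
  assumes "Vector_Spaces.linear L1_scale L1_scale T"
  shows "T a l = (\<Sum>j\<in>UNIV. a j * T (point_mass j) l)"
proof -
  interpret T: Vector_Spaces.linear L1_scale L1_scale T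
    by (rule assms)
  have sum_apply: "(\<Sum>j\<in>A. g j) i = (\<Sum>j\<in>A. g j i)"
    for A :: "'n mod_ring set" and g :: "'n mod_ring \<Rightarrow> 'n L1" and i
    by (induction A rule: infinite_finite_induct) auto
  have "a = (\<Sum>j\<in>UNIV. L1_scale (a j) (point_mass j))"
    by (simp add: fun_eq_iff sum_apply L1_scale_def point_mass_def)
  then have "T a = T (\<Sum>j\<in>UNIV. L1_scale (a j) (point_mass j))"
    by (rule arg_cong)
  also have "\<dots> = (\<Sum>j\<in>UNIV. L1_scale (a j) (T (point_mass j)))"
    by (simp add: T.sum T.scale)
  finally show ?thesis
    by (simp add: sum_apply L1_scale_def)
qed

lemma translation_point_mass:
  "translation k (point_mass j) = point_mass (j - of_int_mod_ring k)"
  by (auto simp: translation_def point_mass_def fun_eq_iff algebra_simps)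

lemma modulation_point_mass:
  "modulation \<psi> k (point_mass j) = L1_scale (exp (of_int k * \<psi> j)) (point_mass j)"
  by (auto simp: modulation_def point_mass_def L1_scale_def fun_eq_iff)

text \<open>
  A translation by \<open>-k\<close> moves the point mass forward by \<open>k\<close>; this is where the minus sign of the
  Fourier kernel comes from.
\<close>

lemma matrix_row_step:
  assumes "\<And>k::int. T \<circ> translation k = modulation \<phi> k \<circ> T"
  shows "T (point_mass (j + of_int_mod_ring k)) l
           = exp (of_int k * (- \<phi> l)) * T (point_mass j) l"
proof -
  have neg: "of_int_mod_ring (- k) = - (of_int_mod_ring k :: 'a mod_ring)"
    by (simp add: eq_neg_iff_add_eq_0) (transfer, simp add: mod_simps)
  show ?thesis
    using assms [of "- k", THEN fun_cong, of "point_mass j", THEN fun_cong, of l]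
    by (simp add: translation_point_mass modulation_def neg)
qed

lemma matrix_column_step:
  assumes lin: "Vector_Spaces.linear L1_scale L1_scale T"
    and "\<And>k::int. T \<circ> modulation \<psi> k = translation k \<circ> T"
  shows "T (point_mass j) (l + of_int_mod_ring k) = exp (of_int k * \<psi> j) * T (point_mass j) l"
proof -
  interpret T: Vector_Spaces.linear L1_scale L1_scale T
    by (rule lin)
  have "T (modulation \<psi> k (point_mass j)) l = exp (of_int k * \<psi> j) * T (point_mass j) l"
    unfolding modulation_point_mass T.scale by (simp add: L1_scale_def)
  then show ?thesis
    using assms(2) [of k, THEN fun_cong, of "point_mass j", THEN fun_cong, of l]
    by (simp add: translation_def)
qed

text \<open>
  An entry of \<open>K\<close> is reached from \<open>K 0 0\<close> along the column \<open>0\<close> and then a row, or along the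
  row \<open>0\<close> and then a column. That both ways give the same value ties the row ratios \<open>p\<close> to the
  column ratios \<open>q\<close> so tightly that only affine maps are left. The ring unit is written
  \<open>of_int_mod_ring 1\<close>, which makes sense in the zero ring as well.
\<close>

lemma bigeometric_matrix:
  fixes K :: "'n::finite mod_ring \<Rightarrow> 'n mod_ring \<Rightarrow> complex"
  assumes row: "\<And>l j. K l j = K l 0 * addchar (- p l * j)"
    and col: "\<And>l j. K l j = K 0 j * addchar (q j * l)"
    and nz: "K 0 0 \<noteq> 0"
  shows "\<exists>k\<^sub>0 m\<^sub>0 m\<^sub>1. (\<forall>l. p l = k\<^sub>0 * l + m\<^sub>0) \<and> (\<forall>j. q j = - k\<^sub>0 * j + m\<^sub>1) \<and>
    (\<forall>l j. K l j = K 0 0 * addchar (l * m\<^sub>1) * addchar (- ((k\<^sub>0 * l + m\<^sub>0) * j)))"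
proof -
  let ?u = "of_int_mod_ring 1 :: 'n mod_ring"
  have u: "x * ?u = x" for x
    using of_int_1_mult [of x] by (simp add: mult.commute)
  have via_column: "K l j = K 0 0 * addchar (q 0 * l - p l * j)" for l j
    using row [of l j] col [of l 0] by (simp add: addchar_add [symmetric] mult.assoc)
  have via_row: "K l j = K 0 0 * addchar (q j * l - p 0 * j)" for l j
    using col [of l j] row [of 0 j]
    by (simp add: addchar_add [symmetric] mult.assoc algebra_simps)
  have exchange: "q 0 * l - p l * j = q j * l - p 0 * j" for l j
  proof -
    have "addchar (q 0 * l - p l * j) = addchar (q j * l - p 0 * j)"
      using via_column [of l j] via_row [of l j] nz by simp
    then show ?thesis
      by (rule injD [OF inj_addchar])
  qed
  define k\<^sub>0 where "k\<^sub>0 = q 0 - q ?u"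
  have p: "p l = k\<^sub>0 * l + p 0" for l
    using exchange [of l ?u] by (simp add: u of_int_1_mult k\<^sub>0_def algebra_simps)
  have q: "q j = - k\<^sub>0 * j + q 0" for j
    using exchange [of ?u j] p [of ?u] by (simp add: u of_int_1_mult algebra_simps)
  have "K l j = K 0 0 * addchar (l * q 0) * addchar (- ((k\<^sub>0 * l + p 0) * j))" for l j
    using via_column [of l j] p [of l]
    by (simp add: addchar_diff addchar_minus divide_inverse mult.commute mult.left_commute)
  with p q show ?thesis
    by blast
qed

section \<open>Operators intertwining translations and modulations\<close>

theorem theorem2p5:
  fixes T :: "'n::finite L1 \<Rightarrow> 'n L1"
    and \<phi> \<psi> :: "'n mod_ring \<Rightarrow> complex"
  assumes "Vector_Spaces.linear L1_scale L1_scale T"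
    and "continuous_map L1_topology L1_topology T"
    and "T \<noteq> 0"
    and "\<And>k::int. T \<circ> translation k = modulation \<phi> k \<circ> T"
    and "\<And>k::int. T \<circ> modulation \<psi> k = translation k \<circ> T"
  shows "\<exists>(k\<^sub>0 :: 'n mod_ring) (m\<^sub>0 :: 'n mod_ring) (m\<^sub>1 :: 'n mod_ring) (c :: complex).
    (\<forall>j. cong_2pi_i (\<phi> j)
           (2 * \<i> * of_real pi / of_nat CARD('n) * of_int (to_int_mod_ring (k\<^sub>0 * j + m\<^sub>0))) \<and>
         cong_2pi_i (\<psi> j)
           (2 * \<i> * of_real pi / of_nat CARD('n) * of_int (to_int_mod_ring (- k\<^sub>0 * j + m\<^sub>1)))) \<and>
    (\<forall>a l. T a l =
           c * exp (2 * \<i> * of_real pi * of_int (to_int_mod_ring l) * of_int (to_int_mod_ring m\<^sub>1)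
                    / of_nat CARD('n))
             * fourier a (k\<^sub>0 * l + m\<^sub>0))"
proof -
  note lin = assms(1)
  define K where "K l j = T (point_mass j) l" for l j
  have expand: "T a l = (\<Sum>j\<in>UNIV. a j * K l j)" for a l
    unfolding K_def by (rule L1_linear_expansion [OF lin])
  have row_step: "K l (j + of_int_mod_ring k) = exp (of_int k * (- \<phi> l)) * K l j" for l j k
    unfolding K_def by (rule matrix_row_step [OF assms(4)])
  have col_step: "K (l + of_int_mod_ring k) j = exp (of_int k * \<psi> j) * K l j" for l j k
    unfolding K_def by (rule matrix_column_step [OF lin assms(5)])
  \<comment> \<open>Any two entries in the same row or column differ by a nonzero factor.\<close>
  have row_shift: "K l j' = exp (of_int (to_int_mod_ring (j' - j)) * (- \<phi> l)) * K l j" for l j j'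
    using row_step [of l j "to_int_mod_ring (j' - j)"] by simp
  have col_shift: "K l' j = exp (of_int (to_int_mod_ring (l' - l)) * \<psi> j) * K l j" for l l' j
    using col_step [of l "to_int_mod_ring (l' - l)" j] by simp
  have "\<exists>l j. K l j \<noteq> 0"
  proof (rule ccontr)
    assume "\<nexists>l j. K l j \<noteq> 0"
    then have "T = 0"
      by (simp add: fun_eq_iff expand)
    with \<open>T \<noteq> 0\<close> show False ..
  qed
  then obtain l\<^sub>1 j\<^sub>1 where "K l\<^sub>1 j\<^sub>1 \<noteq> 0"
    by blast
  then have nz: "K l j \<noteq> 0" for l j
    using row_shift [of l\<^sub>1 j j\<^sub>1] col_shift [of l j l\<^sub>1] by simp
  have "\<exists>p. exp (\<phi> l) = addchar p \<and> (\<forall>j. K l j = K l 0 * addchar (- p * j))" for l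
  proof -
    obtain p where p: "exp (- \<phi> l) = addchar p" "\<forall>j. K l j = K l 0 * addchar (p * j)"
      using geometric_cyclic [where f = "K l" and z = "- \<phi> l", OF row_step nz] by blast
    have "exp (\<phi> l) = addchar (- p)"
      by (simp add: addchar_minus exp_minus p(1) [symmetric])
    moreover have "\<forall>j. K l j = K l 0 * addchar (- (- p) * j)"
      using p(2) unfolding minus_minus .
    ultimately show ?thesis
      by blast
  qed
  then obtain p where p: "\<And>l. exp (\<phi> l) = addchar (p l)"
      and row: "\<And>l j. K l j = K l 0 * addchar (- p l * j)"
    by metis
  have "\<exists>q. exp (\<psi> j) = addchar q \<and> (\<forall>l. K l j = K 0 j * addchar (q * l))" for j
    by (rule geometric_cyclic [where f = "\<lambda>l. K l j" and z = "\<psi> j", OF col_step nz])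
  then obtain q where q: "\<And>j. exp (\<psi> j) = addchar (q j)"
      and col: "\<And>l j. K l j = K 0 j * addchar (q j * l)"
    by metis
  obtain k\<^sub>0 m\<^sub>0 m\<^sub>1 where p_affine: "\<And>l. p l = k\<^sub>0 * l + m\<^sub>0"
      and q_affine: "\<And>j. q j = - k\<^sub>0 * j + m\<^sub>1"
      and K: "\<And>l j. K l j = K 0 0 * addchar (l * m\<^sub>1) * addchar (- ((k\<^sub>0 * l + m\<^sub>0) * j))"
    using bigeometric_matrix [of K p q, OF row col nz] by blast
  have T_fourier: "T a l = K 0 0 * addchar (l * m\<^sub>1) * fourier a (k\<^sub>0 * l + m\<^sub>0)" for a l
  proof -
    have "T a l = (\<Sum>j\<in>UNIV. a j * (K 0 0 * addchar (l * m\<^sub>1) * addchar (- ((k\<^sub>0 * l + m\<^sub>0) * j))))"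
      unfolding expand by (intro sum.cong refl arg_cong2 [where f = times] K)
    then show ?thesis
      unfolding fourier_eq_addchar by (simp add: sum_distrib_left mult_ac)
  qed
  have "addchar (l * m\<^sub>1) = exp (2 * \<i> * of_real pi * of_int (to_int_mod_ring l)
      * of_int (to_int_mod_ring m\<^sub>1) / of_nat CARD('n))" for l
    unfolding mult_eq_of_int addchar_of_int by (simp add: mult_ac)
  then show ?thesis
    unfolding cong_2pi_i_iff_addchar
    using p q T_fourier unfolding p_affine q_affine
    by (intro exI [of _ k\<^sub>0] exI [of _ m\<^sub>0] exI [of _ m\<^sub>1] exI [of _ "K 0 0"]) simp
qed

end
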